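(* Let $a,b\in\mathbb{R}$ with $0<|a|<|b|<1$ and $\operatorname{sgn}(a)=\operatorname{sgn}(b)$, let $\sigma_Z>0$, and let $Z_n\sim\mathcal{N}(0,\sigma_Z^2)$ be i.i.d. Consider the linear stochastic system $X_n=aX_{n-1}+Z_n-U_n$ in steady state, where under $\mathcal{H}_0$ there is no control ($U_n=0$), and under $\mathcal{H}_1$ Alice uses the control $U_n=(a-b)X_{n-1}$ (so that $X_n=bX_{n-1}+Z_n$). Suppose Willie observes the system's output $(X_1,\dots,X_n)$ through a clean (noiseless) channel over a time window of length $n<\frac{2b}{b-a}$ and knows the control rule $U_n$. Then for every $\varepsilon>0$ such that $$|b|<\sqrt{1-(1-a^2)e^{-4\varepsilon^2}},$$ and for any method of detection that Willie uses, Alice achieves $\varepsilon$-covertness.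
   Context: Willie tests $\mathcal{H}_0$ (no control) against $\mathcal{H}_1$ (control) from his observations. For a test, $\alpha$ is the false alarm probability (deciding $\mathcal{H}_1$ when $\mathcal{H}_0$ is true) and $\beta$ is the miss detection probability (deciding $\mathcal{H}_0$ when $\mathcal{H}_1$ is true). Alice achieves $\varepsilon$-covertness if $\alpha+\beta\ge 1-\varepsilon$. "In steady state" means that the process is the stationary one: under $\mathcal{H}_0$ the vector $(X_1,\dots,X_n)$ is $\mathcal{N}(0,\Sigma_0)$ with $[\Sigma_0]_{ij}=\frac{\sigma_Z^2}{1-a^2}a^{|i-j|}$, and under $\mathcal{H}_1$ it is $\mathcal{N}(0,\Sigma_1)$ with $[\Sigma_1]_{ij}=\frac{\sigma_Z^2}{1-b^2}b^{|i-j|}$, $1\le i,j\le n$. *)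

theory Defs
  imports
    "HOL-Probability.Probability"
    "Jordan_Normal_Form.Determinant"
    "Jordan_Normal_Form.Gauss_Jordan_Elimination"
begin

(* Time runs over the naturals; the noise that matters is Z 1, Z 2, ...  Null sets on which the
   recursion may fail are allowed. *)
definition iid_normal_noise :: "'w measure \<Rightarrow> real \<Rightarrow> (nat \<Rightarrow> 'w \<Rightarrow> real) \<Rightarrow> bool" where
  "iid_normal_noise M \<sigma> Z \<longleftrightarrow>
     prob_space.indep_vars M (\<lambda>_. borel) Z {1..} \<and>
     (\<forall>k\<ge>1. distributed M lborel (Z k) (normal_density 0 \<sigma>))"

definition linear_system ::
  "'w measure \<Rightarrow> real \<Rightarrow> real \<Rightarrow> (nat \<Rightarrow> 'w \<Rightarrow> real) \<Rightarrow> (nat \<Rightarrow> 'w \<Rightarrow> real) \<Rightarrow> (nat \<Rightarrow> 'w \<Rightarrow> real) \<Rightarrow> bool" where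
  "linear_system M a \<sigma> Z U X \<longleftrightarrow>
     prob_space M \<and>
     iid_normal_noise M \<sigma> Z \<and>
     (\<forall>k. X k \<in> borel_measurable M) \<and>
     (\<forall>k\<ge>1. AE \<omega> in M. X k \<omega> = a * X (k - 1) \<omega> + Z k \<omega> - U k \<omega>)"

definition observation :: "nat \<Rightarrow> (nat \<Rightarrow> 'w \<Rightarrow> real) \<Rightarrow> 'w \<Rightarrow> nat \<Rightarrow> real" where
  "observation n X \<omega> = (\<lambda>i\<in>{1..n}. X i \<omega>)"

(* Density of N(0,S) for a symmetric positive definite n x n matrix S.  mat_inverse S is Some of the
   inverse whenever S is invertible. *)
definition centered_normal_density :: "real mat \<Rightarrow> real Matrix.vec \<Rightarrow> real" where
  "centered_normal_density S x =
     1 / sqrt ((2 * pi) ^ dim_row S * Determinant.det S) *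
     exp (- scalar_prod x (the (mat_inverse S) *\<^sub>v x) / 2)"

(* Coordinates 1..n of an observation become entries 0..<n of the vector. *)
definition has_centered_normal_law ::
  "'w measure \<Rightarrow> nat \<Rightarrow> ('w \<Rightarrow> nat \<Rightarrow> real) \<Rightarrow> real mat \<Rightarrow> bool" where
  "has_centered_normal_law M n Y S \<longleftrightarrow>
     distributed M (Pi\<^sub>M {1..n} (\<lambda>_. lborel)) Y
       (\<lambda>y. ennreal (centered_normal_density S (Matrix.vec n (\<lambda>i. y (Suc i)))))"

(* The shift between the index ranges 1..n and 0..<n does not affect |i - j|. *)
definition stationary_covariance :: "nat \<Rightarrow> real \<Rightarrow> real \<Rightarrow> real mat" where
  "stationary_covariance n c \<sigma> =
     Matrix.mat n n (\<lambda>(i, j). \<sigma>\<^sup>2 / (1 - c\<^sup>2) * c ^ nat \<bar>int i - int j\<bar>)"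

definition steady_state :: "'w measure \<Rightarrow> nat \<Rightarrow> real \<Rightarrow> real \<Rightarrow> (nat \<Rightarrow> 'w \<Rightarrow> real) \<Rightarrow> bool" where
  "steady_state M n c \<sigma> X \<longleftrightarrow>
     has_centered_normal_law M n (observation n X) (stationary_covariance n c \<sigma>)"

datatype hypothesis = H0 | H1

(* A possibly randomized test: the decision is a measurable function of the observed vector and of a
   private random seed drawn from R, independent of the observations.  A deterministic test is one
   that ignores the seed. *)
definition detection_test :: "nat \<Rightarrow> 'r measure \<Rightarrow> ((nat \<Rightarrow> real) \<times> 'r \<Rightarrow> hypothesis) \<Rightarrow> bool" where
  "detection_test n R d \<longleftrightarrow>
     prob_space R \<and>
     d \<in> measurable (Pi\<^sub>M {1..n} (\<lambda>_. borel) \<Otimes>\<^sub>M R) (count_space UNIV)"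

definition decision_prob ::
  "hypothesis \<Rightarrow> nat \<Rightarrow> 'w measure \<Rightarrow> (nat \<Rightarrow> 'w \<Rightarrow> real) \<Rightarrow> 'r measure \<Rightarrow>
   ((nat \<Rightarrow> real) \<times> 'r \<Rightarrow> hypothesis) \<Rightarrow> real" where
  "decision_prob h n M X R d =
     measure (M \<Otimes>\<^sub>M R) {p \<in> space (M \<Otimes>\<^sub>M R). d (observation n X (fst p), snd p) = h}"

(* M0 and X0 describe the model under H0. *)
definition false_alarm_prob ::
  "nat \<Rightarrow> 'w measure \<Rightarrow> (nat \<Rightarrow> 'w \<Rightarrow> real) \<Rightarrow> 'r measure \<Rightarrow>
   ((nat \<Rightarrow> real) \<times> 'r \<Rightarrow> hypothesis) \<Rightarrow> real" where
  "false_alarm_prob n M0 X0 R d = decision_prob H1 n M0 X0 R d"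

(* M1 and X1 describe the model under H1. *)
definition miss_detection_prob ::
  "nat \<Rightarrow> 'w measure \<Rightarrow> (nat \<Rightarrow> 'w \<Rightarrow> real) \<Rightarrow> 'r measure \<Rightarrow>
   ((nat \<Rightarrow> real) \<times> 'r \<Rightarrow> hypothesis) \<Rightarrow> real" where
  "miss_detection_prob n M1 X1 R d = decision_prob H0 n M1 X1 R d"

definition covert :: "real \<Rightarrow> real \<Rightarrow> real \<Rightarrow> bool" where
  "covert \<epsilon> \<alpha> \<beta> \<longleftrightarrow> \<alpha> + \<beta> \<ge> 1 - \<epsilon>"

end

theory Submission
  imports Defs "HOL-Probability.Hoeffding"
begin

text \<open>
  By Pinsker's inequality the sum \<open>\<alpha> + \<beta>\<close> of the error probabilities of any test is at least
  \<open>1 - sqrt (K / 2)\<close>, where \<open>K\<close> is the Kullback-Leibler divergence of the law of the observations without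
  control from the law with control (lemma \<open>test_errors_ar\<close>). So it suffices that \<open>K < 2 \<epsilon>\<^sup>2\<close>.

  The direction of the divergence matters. Under the law without control the process is stationary
  with coefficient \<open>a\<close>, and lemma \<open>kl_divergence_ar\<close> evaluates

    \<open>K = ln ((1 - a\<^sup>2) / (1 - b\<^sup>2)) / 2 + (b - a) (n (b - a) - 2 b) / (2 (1 - a\<^sup>2))\<close>.

  The first term does not depend on \<open>n\<close>, and the hypothesis on \<open>\<bar>b\<bar>\<close> says precisely that it is less than
  \<open>2 \<epsilon>\<^sup>2\<close>. In the second term, \<open>- 2 b (b - a)\<close> is negative because \<open>\<bar>a\<bar> < \<bar>b\<bar>\<close>. The hypothesis on \<open>n\<close> says that
  \<open>n (b - a)\<^sup>2\<close>, the evidence that accumulates with the length of the window, has not overcome this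
  deficit, so the second term is not positive.

  Three ingredients carry the computation. The stationary covariance is diagonalized by the passage to
  innovations, which turns its normal density into a product of one-step transition densities
  (\<open>centered_normal_density_stationary\<close>). Integrating that product coordinate by coordinate yields the
  mean squared prediction errors, and with them the divergence (\<open>prediction_error_moment\<close>). Pinsker's
  inequality is derived from the variational bound on the divergence and Hoeffding's lemma
  (\<open>kl_variational_bound\<close>, \<open>pinsker_test_bound\<close>), directly for \<open>[0, 1]\<close>-valued functions, so that
  randomized tests need no separate treatment.
\<close>

section \<open>Innovations of the stationary autoregressive process\<close>

text \<open>
  Index \<open>i\<close> stands for the step that produces \<open>x (Suc i)\<close>: given the first \<open>i\<close> coordinates, the next one is
  normal with mean \<open>cond_mean c x i\<close> and standard deviation \<open>cond_sd c \<sigma> i\<close>. Step \<open>0\<close> draws from the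
  stationary marginal; it is singled out so that the empty window and the first observation fit the
  same product and the same recursion as all later ones.
\<close>
definition cond_sd :: "real \<Rightarrow> real \<Rightarrow> nat \<Rightarrow> real" where
  "cond_sd c \<sigma> i = (if i = 0 then \<sigma> / sqrt (1 - c\<^sup>2) else \<sigma>)"

definition cond_mean :: "real \<Rightarrow> (nat \<Rightarrow> real) \<Rightarrow> nat \<Rightarrow> real" where
  "cond_mean c x i = (if i = 0 then 0 else c * x i)"

definition ar_density :: "real \<Rightarrow> real \<Rightarrow> nat \<Rightarrow> (nat \<Rightarrow> real) \<Rightarrow> real" where
  "ar_density c \<sigma> n x = (\<Prod>i<n. normal_density (cond_mean c x i) (cond_sd c \<sigma> i) (x (Suc i)))"

text \<open>
  The linear map that sends an observed vector to its innovations, the prediction errors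
  \<open>x\<^sub>i - c x\<^sub>i\<^sub>-\<^sub>1\<close> (with \<open>x\<^sub>0\<close> itself as the first innovation).
\<close>
definition whitening_mat :: "nat \<Rightarrow> real \<Rightarrow> real mat" where
  "whitening_mat n c = Matrix.mat n n (\<lambda>(i, j). if i = j then 1 else if i = Suc j then - c else 0)"

definition innovation_cov :: "nat \<Rightarrow> real \<Rightarrow> real \<Rightarrow> real mat" where
  "innovation_cov n c \<sigma> = Matrix.mat n n (\<lambda>(i, j). if i = j then (cond_sd c \<sigma> i)\<^sup>2 else 0)"

lemma cond_sd_pos: "\<sigma> > 0 \<Longrightarrow> c\<^sup>2 < 1 \<Longrightarrow> cond_sd c \<sigma> i > 0"
  by (simp add: cond_sd_def)

lemma cond_sd_square: "c\<^sup>2 < 1 \<Longrightarrow> (cond_sd c \<sigma> i)\<^sup>2 = (if i = 0 then \<sigma>\<^sup>2 / (1 - c\<^sup>2) else \<sigma>\<^sup>2)"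
  by (simp add: cond_sd_def power_divide)

lemma sum_whitening_row:
  fixes f :: "nat \<Rightarrow> real"
  assumes "i < n"
  shows "(\<Sum>j = 0..<n. (if i = j then 1 else if i = Suc j then - c else 0) * f j)
    = f i - (if i = 0 then 0 else c * f (i - 1))"
proof (cases i)
  case 0
  have "(\<Sum>j = 0..<n. (if i = j then 1 else if i = Suc j then - c else 0) * f j)
      = (\<Sum>j = 0..<n. if j = i then f j else 0)"
    using 0 by (intro sum.cong) auto
  then show ?thesis using assms 0 by simp
next
  case (Suc k)
  have "(\<Sum>j = 0..<n. (if i = j then 1 else if i = Suc j then - c else 0) * f j)
      = (\<Sum>j = 0..<n. (if j = i then f j else 0) + (if j = k then - c * f j else 0))"
    using Suc by (intro sum.cong) auto
  then show ?thesis using assms Suc by (simp add: sum.distrib)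
qed

lemma whitening_mat_carrier [simp]: "whitening_mat n c \<in> carrier_mat n n"
  by (simp add: whitening_mat_def)

lemma innovation_cov_carrier [simp]: "innovation_cov n c \<sigma> \<in> carrier_mat n n"
  by (simp add: innovation_cov_def)

lemma stationary_covariance_carrier [simp]: "stationary_covariance n c \<sigma> \<in> carrier_mat n n"
  by (simp add: stationary_covariance_def)

lemma whitening_mat_mult_vec:
  assumes "v \<in> carrier_vec n" "i < n"
  shows "vec_index (whitening_mat n c *\<^sub>v v) i
    = vec_index v i - (if i = 0 then 0 else c * vec_index v (i - 1))"
  using assms sum_whitening_row[of i n c "vec_index v"]
  by (simp add: whitening_mat_def scalar_prod_def)

lemma whitening_mat_mult_index:
  assumes "A \<in> carrier_mat n n" "i < n" "j < n"
  shows "(whitening_mat n c * A) $$ (i, j)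
    = A $$ (i, j) - (if i = 0 then 0 else c * A $$ (i - 1, j))"
  using assms sum_whitening_row[of i n c "\<lambda>k. A $$ (k, j)"]
  by (simp add: whitening_mat_def scalar_prod_def)

lemma mult_whitening_mat_transpose_index:
  assumes "A \<in> carrier_mat n n" "i < n" "j < n"
  shows "(A * transpose_mat (whitening_mat n c)) $$ (i, j)
    = A $$ (i, j) - (if j = 0 then 0 else c * A $$ (i, j - 1))"
  using assms sum_whitening_row[of j n c "\<lambda>k. A $$ (i, k)"]
  by (simp add: whitening_mat_def scalar_prod_def mult.commute)

lemma det_whitening_mat: "Determinant.det (whitening_mat n c) = 1"
proof -
  have "diag_mat (whitening_mat n c) = replicate n 1"
    by (rule nth_equalityI) (auto simp: diag_mat_def whitening_mat_def)
  then show ?thesis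
    by (subst det_lower_triangular[of n]) (auto simp: whitening_mat_def)
qed

lemma det_innovation_cov: "Determinant.det (innovation_cov n c \<sigma>) = (\<Prod>i<n. (cond_sd c \<sigma> i)\<^sup>2)"
  by (subst det_lower_triangular[of n])
     (auto simp: innovation_cov_def prod_list_diag_prod lessThan_atLeast0)

text \<open>
  The innovations of a stationary autoregressive process are uncorrelated. Subtracting \<open>c\<close> times the
  previous row from each row of the covariance cancels everything below the diagonal, because
  \<open>c \<cdot> c ^ (k - 1) = c ^ k\<close>; doing the same with the columns of the upper triangular result clears the
  rest. This triangular factorization gives both the determinant and the inverse of the covariance.
\<close>
lemma whitening_stationary_covariance:
  assumes "c\<^sup>2 < 1"
  shows "whitening_mat n c * stationary_covariance n c \<sigma> * transpose_mat (whitening_mat n c)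
    = innovation_cov n c \<sigma>"
proof -
  (* the stationary variance, the solution of v = c\<^sup>2 v + \<sigma>\<^sup>2 *)
  define v where "v = \<sigma>\<^sup>2 / (1 - c\<^sup>2)"
  have "v - c * (c * v) = v * (1 - c\<^sup>2)" by (simp add: algebra_simps power2_eq_square)
  also have "\<dots> = \<sigma>\<^sup>2" using assms by (simp add: v_def)
  finally have v: "v - c * (c * v) = \<sigma>\<^sup>2" .
  define U where "U = Matrix.mat n n (\<lambda>(i, j). if i \<le> j then (cond_sd c \<sigma> i)\<^sup>2 * c ^ (j - i) else 0)"
  have cov: "stationary_covariance n c \<sigma> $$ (i, j) = v * c ^ nat \<bar>int i - int j\<bar>"
    if "i < n" "j < n" for i j
    using that by (simp add: stationary_covariance_def v_def)
  have "whitening_mat n c * stationary_covariance n c \<sigma> = U"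
  proof (rule eq_matI)
    fix i j assume "i < dim_row U" "j < dim_col U"
    then have ij: "i < n" "j < n" by (auto simp: U_def)
    show "(whitening_mat n c * stationary_covariance n c \<sigma>) $$ (i, j) = U $$ (i, j)"
    proof (cases i)
      case 0
      then show ?thesis
        using ij assms by (simp add: whitening_mat_mult_index cov U_def cond_sd_square v_def)
    next
      case (Suc k)
      then have k: "k < n" using ij by simp
      show ?thesis
      proof (cases "i \<le> j")
        case True
        then have e: "nat \<bar>int i - int j\<bar> = j - i" "nat \<bar>int k - int j\<bar> = Suc (j - i)"
          using Suc by auto
        have "v * c ^ (j - i) - c * (v * c ^ Suc (j - i)) = (v - c * (c * v)) * c ^ (j - i)"
          by (simp add: algebra_simps)
        moreover have "stationary_covariance n c \<sigma> $$ (i, j) = v * c ^ (j - i)"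
          "stationary_covariance n c \<sigma> $$ (k, j) = v * c ^ Suc (j - i)"
          by (simp_all only: cov[OF ij] cov[OF k ij(2)] e)
        ultimately show ?thesis
          using True ij Suc assms
          by (simp add: whitening_mat_mult_index U_def cond_sd_square v)
      next
        case False
        then have e: "nat \<bar>int i - int j\<bar> = Suc (k - j)" "nat \<bar>int k - int j\<bar> = k - j"
          using Suc by auto
        have "stationary_covariance n c \<sigma> $$ (i, j) = v * c ^ Suc (k - j)"
          "stationary_covariance n c \<sigma> $$ (k, j) = v * c ^ (k - j)"
          by (simp_all only: cov[OF ij] cov[OF k ij(2)] e)
        then show ?thesis
          using False ij Suc by (simp add: whitening_mat_mult_index U_def)
      qed
    qed
  qed (auto simp: U_def whitening_mat_def stationary_covariance_def)
  moreover have "U * transpose_mat (whitening_mat n c) = innovation_cov n c \<sigma>"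
  proof (rule eq_matI)
    fix i j assume "i < dim_row (innovation_cov n c \<sigma>)" "j < dim_col (innovation_cov n c \<sigma>)"
    then have ij: "i < n" "j < n" by (auto simp: innovation_cov_def)
    have U: "U \<in> carrier_mat n n" by (simp add: U_def)
    have "c ^ (j - i) = c * c ^ (j - 1 - i)" if "i < j"
    proof -
      have "j - i = Suc (j - 1 - i)" using that by simp
      then show ?thesis by simp
    qed
    then show "(U * transpose_mat (whitening_mat n c)) $$ (i, j) = innovation_cov n c \<sigma> $$ (i, j)"
      unfolding mult_whitening_mat_transpose_index[OF U ij] using ij
      by (auto simp: U_def innovation_cov_def)
  qed (auto simp: U_def whitening_mat_def innovation_cov_def)
  ultimately show ?thesis by simp
qed

lemma det_stationary_covariance:
  assumes "c\<^sup>2 < 1"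
  shows "Determinant.det (stationary_covariance n c \<sigma>) = (\<Prod>i<n. (cond_sd c \<sigma> i)\<^sup>2)"
proof -
  let ?W = "whitening_mat n c" and ?S = "stationary_covariance n c \<sigma>"
  have "Determinant.det (?W * ?S * transpose_mat ?W)
      = Determinant.det ?W * Determinant.det ?S * Determinant.det (transpose_mat ?W)"
    using det_mult[of "?W * ?S" n "transpose_mat ?W"] det_mult[of ?W n ?S]
      mult_carrier_mat[of ?W n n ?S n] by simp
  also have "\<dots> = Determinant.det ?S"
    using det_transpose[of ?W n] by (simp add: det_whitening_mat)
  finally have "Determinant.det (?W * ?S * transpose_mat ?W) = Determinant.det ?S" .
  then show ?thesis
    by (simp add: whitening_stationary_covariance[OF assms] det_innovation_cov)
qed

lemma mat_inverse_eq:
  fixes A :: "real mat"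
  assumes A: "A \<in> carrier_mat n n" and P: "P \<in> carrier_mat n n" and AP: "A * P = 1\<^sub>m n"
  shows "mat_inverse A = Some P"
proof -
  have PA: "P * A = 1\<^sub>m n" by (rule mat_mult_left_right_inverse[OF A P AP])
  have "A \<in> Units (ring_mat TYPE(real) n ())"
    unfolding Units_def ring_mat_def using A P PA AP by auto
  then obtain Q where Q: "mat_inverse A = Some Q"
    using mat_inverse(1)[OF A, of "()"] by fastforce
  from mat_inverse(2)[OF A this] have *: "A * Q = 1\<^sub>m n" "Q \<in> carrier_mat n n" by auto
  have "Q = P * A * Q" using * PA by simp
  also have "\<dots> = P * (A * Q)" using A P * by (simp add: assoc_mult_mat[of _ n n _ n _ n])
  also have "\<dots> = P" using * P by simp
  finally show ?thesis using Q by simp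
qed

text \<open>
  With \<open>W\<close> the whitening matrix and \<open>E\<close> the inverse of the innovation covariance, the factorization
  \<open>W S W\<^sup>T E = 1\<close> says that \<open>S W\<^sup>T E\<close> is the inverse of \<open>W\<close>. Hence \<open>S\<^sup>-\<^sup>1 = W\<^sup>T E W\<close>, and the quadratic form
  of \<open>S\<^sup>-\<^sup>1\<close> at \<open>v\<close> is the diagonal form \<open>E\<close> at the innovations \<open>W v\<close>.
\<close>
lemma stationary_covariance_quadratic_form:
  assumes c: "c\<^sup>2 < 1" and \<sigma>: "\<sigma> > 0" and v: "v \<in> carrier_vec n"
  shows "scalar_prod v (the (mat_inverse (stationary_covariance n c \<sigma>)) *\<^sub>v v)
    = (\<Sum>i<n. (vec_index (whitening_mat n c *\<^sub>v v) i)\<^sup>2 / (cond_sd c \<sigma> i)\<^sup>2)"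
proof -
  let ?W = "whitening_mat n c" and ?S = "stationary_covariance n c \<sigma>"
  define E where "E = Matrix.mat n n (\<lambda>(i, j). if i = j then 1 / (cond_sd c \<sigma> i)\<^sup>2 else 0)"
  have E [simp]: "E \<in> carrier_mat n n" by (simp add: E_def)
  have W [simp]: "transpose_mat ?W \<in> carrier_mat n n" by simp
  note assoc = mult_carrier_mat[of _ n n _ n] assoc_mult_mat[of _ n n _ n _ n]
  have "innovation_cov n c \<sigma> * E = 1\<^sub>m n"
  proof (rule eq_matI)
    fix i j assume "i < dim_row (1\<^sub>m n :: real mat)" "j < dim_col (1\<^sub>m n :: real mat)"
    then have ij: "i < n" "j < n" by auto
    have "(innovation_cov n c \<sigma> * E) $$ (i, j)
        = (\<Sum>k = 0..<n. (if i = k then (cond_sd c \<sigma> i)\<^sup>2 else 0)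
            * (if k = j then 1 / (cond_sd c \<sigma> k)\<^sup>2 else 0))"
      using ij by (simp add: innovation_cov_def E_def scalar_prod_def)
    also have "\<dots> = (\<Sum>k = 0..<n. if k = i then (if i = j then 1 else 0) else 0)"
      using cond_sd_pos[OF \<sigma> c, of i] by (intro sum.cong) auto
    finally have "(innovation_cov n c \<sigma> * E) $$ (i, j)
        = (\<Sum>k = 0..<n. if k = i then (if i = j then 1 else 0) else 0)" .
    then show "(innovation_cov n c \<sigma> * E) $$ (i, j) = 1\<^sub>m n $$ (i, j)"
      using ij by simp
  qed (auto simp: innovation_cov_def E_def)
  moreover have "?W * (?S * transpose_mat ?W * E) = ?W * ?S * transpose_mat ?W * E"
    by (simp add: assoc)
  ultimately have "?W * (?S * transpose_mat ?W * E) = 1\<^sub>m n"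
    by (simp only: whitening_stationary_covariance[OF c])
  then have "?S * transpose_mat ?W * E * ?W = 1\<^sub>m n"
    by (intro mat_mult_left_right_inverse[of ?W n]) (auto simp: assoc(1))
  then have "?S * (transpose_mat ?W * E * ?W) = 1\<^sub>m n" by (simp add: assoc)
  then have "mat_inverse ?S = Some (transpose_mat ?W * E * ?W)"
    by (intro mat_inverse_eq[of _ n]) (auto simp: assoc(1))
  then have "scalar_prod v (the (mat_inverse ?S) *\<^sub>v v)
      = scalar_prod v (transpose_mat ?W *\<^sub>v (E *\<^sub>v (?W *\<^sub>v v)))"
    using v by (simp add: assoc(1) mult_mat_vec_carrier[of _ n n] assoc_mult_mat_vec[of _ n n _ n])
  also have "\<dots> = scalar_prod (?W *\<^sub>v v) (E *\<^sub>v (?W *\<^sub>v v))"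
    using v transpose_vec_mult_scalar[of ?W n n v "E *\<^sub>v (?W *\<^sub>v v)"]
      comm_scalar_prod[of v n "transpose_mat ?W *\<^sub>v (E *\<^sub>v (?W *\<^sub>v v))"]
      comm_scalar_prod[of "E *\<^sub>v (?W *\<^sub>v v)" n "?W *\<^sub>v v"]
    by (simp add: mult_mat_vec_carrier[of _ n n])
  also have "\<dots> = (\<Sum>i<n. (vec_index (?W *\<^sub>v v) i)\<^sup>2 / (cond_sd c \<sigma> i)\<^sup>2)"
  proof -
    have "vec_index (E *\<^sub>v w) i = vec_index w i / (cond_sd c \<sigma> i)\<^sup>2"
      if "w \<in> carrier_vec n" "i < n" for w i
    proof -
      have "vec_index (E *\<^sub>v w) i
          = (\<Sum>j = 0..<n. (if i = j then 1 / (cond_sd c \<sigma> i)\<^sup>2 else 0) * vec_index w j)"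
        using that by (simp add: E_def scalar_prod_def)
      also have "\<dots> = (\<Sum>j = 0..<n. if j = i then vec_index w i / (cond_sd c \<sigma> i)\<^sup>2 else 0)"
        by (intro sum.cong) auto
      finally show ?thesis using that by simp
    qed
    note diag = this
    have W: "?W *\<^sub>v v \<in> carrier_vec n" using v by (simp add: mult_mat_vec_carrier[of _ n n])
    have "dim_vec (E *\<^sub>v (?W *\<^sub>v v)) = n" by (simp add: E_def)
    then have "scalar_prod (?W *\<^sub>v v) (E *\<^sub>v (?W *\<^sub>v v))
        = (\<Sum>i<n. vec_index (?W *\<^sub>v v) i * vec_index (E *\<^sub>v (?W *\<^sub>v v)) i)"
      by (simp only: scalar_prod_def lessThan_atLeast0)
    also have "\<dots> = (\<Sum>i<n. (vec_index (?W *\<^sub>v v) i)\<^sup>2 / (cond_sd c \<sigma> i)\<^sup>2)"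
      by (intro sum.cong refl) (simp only: diag[OF W] lessThan_iff power2_eq_square times_divide_eq_right)
    finally show ?thesis .
  qed
  finally show ?thesis .
qed

text \<open>
  The joint density is the chain of one-step transition densities, that is, the stationary process is
  Markov. This is the form in which the law can be integrated one coordinate at a time.
\<close>
lemma centered_normal_density_stationary:
  assumes c: "c\<^sup>2 < 1" and \<sigma>: "\<sigma> > 0"
  shows "centered_normal_density (stationary_covariance n c \<sigma>) (Matrix.vec n (\<lambda>i. x (Suc i)))
    = ar_density c \<sigma> n x"
proof -
  let ?s = "cond_sd c \<sigma>" and ?e = "\<lambda>i. x (Suc i) - cond_mean c x i"
  let ?v = "Matrix.vec n (\<lambda>i. x (Suc i))"
  have "vec_index (whitening_mat n c *\<^sub>v ?v) i = ?e i" if "i < n" for i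
    using that by (cases i) (simp_all add: whitening_mat_mult_vec cond_mean_def)
  then have q: "scalar_prod ?v (the (mat_inverse (stationary_covariance n c \<sigma>)) *\<^sub>v ?v)
      = (\<Sum>i<n. (?e i)\<^sup>2 / (?s i)\<^sup>2)"
    by (simp add: stationary_covariance_quadratic_form[OF c \<sigma>])
  have d: "(2 * pi) ^ n * Determinant.det (stationary_covariance n c \<sigma>)
      = (\<Prod>i<n. 2 * pi * (?s i)\<^sup>2)"
    by (simp add: det_stationary_covariance[OF c] prod.distrib)
  have "ar_density c \<sigma> n x
      = (\<Prod>i<n. 1 / sqrt (2 * pi * (?s i)\<^sup>2)) * (\<Prod>i<n. exp (- ((?e i)\<^sup>2 / (?s i)\<^sup>2) / 2))"
    by (simp add: ar_density_def normal_density_def prod.distrib[symmetric] mult.commute)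
  also have "(\<Prod>i<n. 1 / sqrt (2 * pi * (?s i)\<^sup>2)) = 1 / sqrt (\<Prod>i<n. 2 * pi * (?s i)\<^sup>2)"
    by (induction n) (simp_all add: real_sqrt_mult)
  also have "(\<Prod>i<n. exp (- ((?e i)\<^sup>2 / (?s i)\<^sup>2) / 2)) = exp (- (\<Sum>i<n. (?e i)\<^sup>2 / (?s i)\<^sup>2) / 2)"
    by (simp add: exp_sum[symmetric] sum_negf sum_divide_distrib)
  finally show ?thesis
    unfolding centered_normal_density_def q using d by (simp add: stationary_covariance_def)
qed

section \<open>Pinsker's inequality for randomized tests\<close>

text \<open>
  The Donsker-Varadhan inequality \<open>E\<^sub>0 h \<le> K + ln (E\<^sub>1 (exp h))\<close> for \<open>h = l (q - \<phi>)\<close>, where \<open>q\<close> is the mean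
  of \<open>\<phi>\<close> under \<open>f1\<close>. It comes from \<open>ln t \<le> t - 1\<close> applied to the tilted likelihood ratio, and Hoeffding's
  lemma bounds the exponential moment by \<open>exp (l\<^sup>2 / 8)\<close>, because \<open>\<phi>\<close> takes its values in an interval of
  length one.
\<close>
lemma kl_variational_bound:
  fixes f0 f1 \<phi> :: "'a \<Rightarrow> real"
  assumes [measurable]: "f0 \<in> borel_measurable B" "f1 \<in> borel_measurable B" "\<phi> \<in> borel_measurable B"
    and pos: "\<And>x. f0 x > 0" "\<And>x. f1 x > 0"
    and mass: "has_bochner_integral B f0 1" "has_bochner_integral B f1 1"
    and \<phi>: "\<And>x. 0 \<le> \<phi> x" "\<And>x. \<phi> x \<le> 1"
    and kl: "has_bochner_integral B (\<lambda>x. f0 x * ln (f0 x / f1 x)) K"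
    and l: "0 < l"
  shows "l * ((\<integral>x. f1 x * \<phi> x \<partial>B) - (\<integral>x. f0 x * \<phi> x \<partial>B)) \<le> K + l\<^sup>2 / 8"
proof -
  define p where "p = (\<integral>x. f0 x * \<phi> x \<partial>B)"
  define q where "q = (\<integral>x. f1 x * \<phi> x \<partial>B)"
  have "integrable B (\<lambda>x. f0 x * \<phi> x)"
  proof (rule Bochner_Integration.integrable_bound)
    show "integrable B f0" using mass by (simp add: has_bochner_integral_iff)
    show "AE x in B. norm (f0 x * \<phi> x) \<le> norm (f0 x)"
      using pos \<phi> by (intro AE_I2) (simp add: abs_mult mult_left_le)
  qed simp
  then have p: "has_bochner_integral B (\<lambda>x. f0 x * \<phi> x) p"
    unfolding p_def by (rule has_bochner_integral_integrable)
  let ?N = "density B f1"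
  interpret N: prob_space ?N
  proof
    have "emeasure ?N (space ?N) = (\<integral>\<^sup>+x. ennreal (f1 x) \<partial>B)"
      by (simp add: emeasure_density cong: nn_integral_cong)
    also have "\<dots> = ennreal 1"
      using mass(2) pos by (intro nn_integral_eq_integral[THEN trans])
        (auto simp: has_bochner_integral_iff less_imp_le)
    finally show "emeasure ?N (space ?N) = 1" by simp
  qed
  (* Hoeffding's lemma controls only positive exponents, so it is applied to the negative of \<phi> *)
  interpret N: interval_bounded_random_variable ?N "\<lambda>x. - \<phi> x" "-1" 0
    by unfold_locales (use \<phi> in auto)
  have "N.expectation (\<lambda>x. - \<phi> x) = - q"
    using pos by (subst integral_density) (auto simp: q_def less_imp_le)
  then have "(\<integral>\<^sup>+x. exp (l * (q - \<phi> x)) \<partial>?N) \<le> ennreal (exp (l\<^sup>2 / 8))"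
    using N.Hoeffdings_lemma_nn_integral[OF l] by (simp add: add.commute)
  also have "(\<integral>\<^sup>+x. exp (l * (q - \<phi> x)) \<partial>?N) = (\<integral>\<^sup>+x. ennreal (f1 x * exp (l * (q - \<phi> x))) \<partial>B)"
    using pos by (subst nn_integral_density) (auto simp: ennreal_mult less_imp_le intro!: nn_integral_cong)
  finally have le: "(\<integral>\<^sup>+x. ennreal (f1 x * exp (l * (q - \<phi> x))) \<partial>B) \<le> ennreal (exp (l\<^sup>2 / 8))" .
  then have int: "integrable B (\<lambda>x. f1 x * exp (l * (q - \<phi> x)))"
    using pos by (intro integrableI_nonneg) (auto simp: less_imp_le intro: le_less_trans)
  define r where "r = (\<integral>x. f1 x * exp (l * (q - \<phi> x)) \<partial>B)"
  have "ennreal r \<le> ennreal (exp (l\<^sup>2 / 8))"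
    using le pos unfolding r_def by (subst nn_integral_eq_integral[OF int, symmetric]) (auto simp: less_imp_le)
  then have r: "r \<le> exp (l\<^sup>2 / 8)" by simp
  have lower: "has_bochner_integral B
      (\<lambda>x. (l * q - l\<^sup>2 / 8) * f0 x - l * (f0 x * \<phi> x) - f0 x * ln (f0 x / f1 x))
      ((l * q - l\<^sup>2 / 8) * 1 - l * p - K)"
    by (intro has_bochner_integral_diff has_bochner_integral_mult_right mass p kl)
  have upper: "has_bochner_integral B
      (\<lambda>x. exp (- (l\<^sup>2 / 8)) * (f1 x * exp (l * (q - \<phi> x))) - f0 x) (exp (- (l\<^sup>2 / 8)) * r - 1)"
    unfolding r_def
    by (intro has_bochner_integral_diff has_bochner_integral_mult_right mass
        has_bochner_integral_integrable int)
  have "(l * q - l\<^sup>2 / 8) * 1 - l * p - K \<le> exp (- (l\<^sup>2 / 8)) * r - 1"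
    unfolding has_bochner_integral_integral_eq[OF lower, symmetric]
      has_bochner_integral_integral_eq[OF upper, symmetric]
  proof (rule integral_mono)
    show "integrable B (\<lambda>x. (l * q - l\<^sup>2 / 8) * f0 x - l * (f0 x * \<phi> x) - f0 x * ln (f0 x / f1 x))"
      using lower by (simp add: has_bochner_integral_iff)
    show "integrable B (\<lambda>x. exp (- (l\<^sup>2 / 8)) * (f1 x * exp (l * (q - \<phi> x))) - f0 x)"
      using upper by (simp add: has_bochner_integral_iff)
    fix x
    (* likelihood ratio of f1 tilted by exp h, normalized by the Hoeffding bound, against f0 *)
    let ?t = "exp (l * (q - \<phi> x) - l\<^sup>2 / 8) * (f1 x / f0 x)"
    have "ln ?t \<le> ?t - 1" using pos by (intro ln_le_minus_one) simp
    moreover have "ln ?t = l * (q - \<phi> x) - l\<^sup>2 / 8 - ln (f0 x / f1 x)"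
      using pos[of x] by (simp add: ln_mult ln_div)
    ultimately have "f0 x * (l * (q - \<phi> x) - l\<^sup>2 / 8 - ln (f0 x / f1 x)) \<le> f0 x * (?t - 1)"
      using pos(1)[of x] by (intro mult_left_mono) auto
    also have "f0 x * (?t - 1) = exp (l * (q - \<phi> x) - l\<^sup>2 / 8) * f1 x - f0 x"
      using pos(1)[of x] by (simp add: algebra_simps)
    also have "exp (l * (q - \<phi> x) - l\<^sup>2 / 8) = exp (- (l\<^sup>2 / 8)) * exp (l * (q - \<phi> x))"
      by (simp add: mult_exp_exp)
    finally show "(l * q - l\<^sup>2 / 8) * f0 x - l * (f0 x * \<phi> x) - f0 x * ln (f0 x / f1 x)
        \<le> exp (- (l\<^sup>2 / 8)) * (f1 x * exp (l * (q - \<phi> x))) - f0 x"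
      by (simp add: algebra_simps)
  qed
  moreover have "exp (- (l\<^sup>2 / 8)) * r \<le> exp (- (l\<^sup>2 / 8)) * exp (l\<^sup>2 / 8)"
    using r by (intro mult_left_mono) auto
  ultimately have "(l * q - l\<^sup>2 / 8) * 1 - l * p - K \<le> 0" by (simp add: mult_exp_exp)
  then show ?thesis unfolding p_def q_def by (simp add: algebra_simps)
qed

text \<open>
  Pinsker's inequality in the form needed for tests, where \<open>\<phi>\<close> plays the role of the rejection
  probability. Optimizing the variational bound over \<open>l\<close> gives \<open>l = 4 t\<close>, where \<open>t\<close> is the difference of
  the means.
\<close>
lemma pinsker_test_bound:
  fixes f0 f1 \<phi> :: "'a \<Rightarrow> real"
  assumes f: "f0 \<in> borel_measurable B" "f1 \<in> borel_measurable B"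
    and \<phi>_meas: "\<phi> \<in> borel_measurable B"
    and pos: "\<And>x. f0 x > 0" "\<And>x. f1 x > 0"
    and mass: "has_bochner_integral B f0 1" "has_bochner_integral B f1 1"
    and \<phi>: "\<And>x. 0 \<le> \<phi> x" "\<And>x. \<phi> x \<le> 1"
    and kl: "has_bochner_integral B (\<lambda>x. f0 x * ln (f0 x / f1 x)) K"
  shows "(\<integral>x. f1 x * \<phi> x \<partial>B) - (\<integral>x. f0 x * \<phi> x \<partial>B) \<le> sqrt (K / 2)"
proof -
  let ?t = "(\<integral>x. f1 x * \<phi> x \<partial>B) - (\<integral>x. f0 x * \<phi> x \<partial>B)"
  (* needed when t \<le> 0, since the square root of a negative number is negative; with \<phi> = 0 the
     variational bound reads 0 \<le> K + l\<^sup>2 / 8, which this choice of l turns into 0 \<le> K / 2 *)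
  have "K \<ge> 0"
  proof (rule ccontr)
    assume "\<not> K \<ge> 0"
    then show False
      using kl_variational_bound[OF f _ pos mass _ _ kl, of "\<lambda>_. 0" "sqrt (- 4 * K)"] by simp
  qed
  show ?thesis
  proof (cases "?t > 0")
    case True
    then have "4 * ?t * ?t \<le> K + (4 * ?t)\<^sup>2 / 8"
      by (intro kl_variational_bound[OF f \<phi>_meas pos mass \<phi> kl]) simp
    then have "?t\<^sup>2 \<le> K / 2" by (simp only: power2_eq_square)
    then show ?thesis by (rule real_le_rsqrt)
  next
    case False
    moreover have "0 \<le> sqrt (K / 2)" using \<open>K \<ge> 0\<close> by simp
    ultimately show ?thesis by linarith
  qed
qed

section \<open>Reducing a seeded test to a randomized decision rule\<close>

text \<open>
  The randomized decision rule, a Markov kernel from observations to decisions, that a seeded test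
  induces.
\<close>
definition decision_kernel ::
  "hypothesis \<Rightarrow> 'r measure \<Rightarrow> ((nat \<Rightarrow> real) \<times> 'r \<Rightarrow> hypothesis) \<Rightarrow> (nat \<Rightarrow> real) \<Rightarrow> real" where
  "decision_kernel h R d y = measure R {r \<in> space R. d (y, r) = h}"

text \<open>
  The seed is independent of the observation, so it can be integrated out first (Fubini). This reduces
  the comparison of the two hypotheses to integrals against the two observation densities, whatever
  the underlying probability spaces.
\<close>
lemma decision_prob_eq_integral:
  assumes M: "prob_space M" and d: "detection_test n R d"
    and Y: "distributed M (Pi\<^sub>M {1..n} (\<lambda>_. lborel)) (observation n X) (\<lambda>y. ennreal (f y))"
    and [measurable]: "f \<in> borel_measurable (Pi\<^sub>M {1..n} (\<lambda>_. lborel))"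
    and pos: "\<And>x. f x > 0"
  shows "decision_kernel h R d \<in> borel_measurable (Pi\<^sub>M {1..n} (\<lambda>_. lborel))"
    "decision_prob h n M X R d
      = (\<integral>y. f y * decision_kernel h R d y \<partial>Pi\<^sub>M {1..n} (\<lambda>_. lborel))"
proof -
  interpret M: prob_space M by fact
  interpret R: prob_space R using d by (simp add: detection_test_def)
  let ?B = "Pi\<^sub>M {1..n} (\<lambda>_. lborel) :: (nat \<Rightarrow> real) measure"
  have sets: "sets (Pi\<^sub>M {1..n} (\<lambda>_. borel)) = sets ?B" by (intro sets_PiM_cong) auto
  have eq: "measurable (Pi\<^sub>M {1..n} (\<lambda>_. borel) \<Otimes>\<^sub>M R) (count_space (UNIV :: hypothesis set))
      = measurable (?B \<Otimes>\<^sub>M R) (count_space UNIV)"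
    by (intro measurable_cong_sets sets_pair_measure_cong sets refl)
  have [measurable]: "d \<in> measurable (?B \<Otimes>\<^sub>M R) (count_space UNIV)"
    using d unfolding detection_test_def eq by blast
  have [measurable]: "observation n X \<in> measurable M ?B"
    using Y by (simp add: distributed_def)
  have "(\<lambda>y. emeasure R (Pair y -` {p \<in> space (?B \<Otimes>\<^sub>M R). d p = h})) \<in> borel_measurable ?B"
    by (intro R.measurable_emeasure_Pair) measurable
  then have "(\<lambda>y. measure R (Pair y -` {p \<in> space (?B \<Otimes>\<^sub>M R). d p = h})) \<in> borel_measurable ?B"
    unfolding measure_def by measurable
  also have "?this \<longleftrightarrow> decision_kernel h R d \<in> borel_measurable ?B"
    unfolding decision_kernel_def
    by (intro measurable_cong arg_cong[where f = "measure R"]) (auto simp: space_pair_measure)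
  finally show meas [measurable]: "decision_kernel h R d \<in> borel_measurable ?B" .
  let ?A = "{p \<in> space (M \<Otimes>\<^sub>M R). d (observation n X (fst p), snd p) = h}"
  have "emeasure (M \<Otimes>\<^sub>M R) ?A = (\<integral>\<^sup>+\<omega>. emeasure R (Pair \<omega> -` ?A) \<partial>M)"
    by (intro R.emeasure_pair_measure_alt) measurable
  also have "\<dots> = (\<integral>\<^sup>+\<omega>. ennreal (decision_kernel h R d (observation n X \<omega>)) \<partial>M)"
    unfolding decision_kernel_def R.emeasure_eq_measure
    by (intro nn_integral_cong arg_cong[where f = "\<lambda>A. ennreal (measure R A)"])
      (auto simp: space_pair_measure)
  finally have "decision_prob h n M X R d
      = enn2real (\<integral>\<^sup>+\<omega>. ennreal (decision_kernel h R d (observation n X \<omega>)) \<partial>M)"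
    unfolding decision_prob_def by (simp only: measure_def)
  also have "\<dots> = (\<integral>\<omega>. decision_kernel h R d (observation n X \<omega>) \<partial>M)"
  proof (rule integral_eq_nn_integral[symmetric])
    show "(\<lambda>\<omega>. decision_kernel h R d (observation n X \<omega>)) \<in> borel_measurable M" by measurable
  qed (simp add: decision_kernel_def)
  also have "\<dots> = (\<integral>y. f y * decision_kernel h R d y \<partial>?B)"
    using pos by (intro distributed_integral[OF Y meas, symmetric]) (simp add: less_imp_le)
  finally show "decision_prob h n M X R d = (\<integral>y. f y * decision_kernel h R d y \<partial>?B)" .
qed

lemma decision_kernel_H0:
  assumes d: "detection_test n R d" and y: "y \<in> space (Pi\<^sub>M {1..n} (\<lambda>_. borel))"
  shows "decision_kernel H0 R d y = 1 - decision_kernel H1 R d y"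
proof -
  interpret R: prob_space R using d by (simp add: detection_test_def)
  have [measurable]: "d \<in> measurable (Pi\<^sub>M {1..n} (\<lambda>_. borel) \<Otimes>\<^sub>M R) (count_space UNIV)"
    using d by (simp add: detection_test_def)
  have H1: "{r \<in> space R. d (y, r) = H1} \<in> sets R" using y by measurable
  have "{r \<in> space R. d (y, r) = H0} = space R - {r \<in> space R. d (y, r) = H1}"
  proof -
    have "h = H0 \<longleftrightarrow> h \<noteq> H1" for h by (cases h) auto
    then show ?thesis by blast
  qed
  then show ?thesis
    unfolding decision_kernel_def using R.prob_compl[OF H1] by (rule ssubst)
qed

section \<open>Moments of the prediction errors\<close>

(* keeps the index set {1..n} of the observation space in this form during simplification *)
declare One_nat_def [simp del]

abbreviation obs_space :: "nat \<Rightarrow> (nat \<Rightarrow> real) measure" where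
  "obs_space n \<equiv> Pi\<^sub>M {1..n} (\<lambda>_. lborel)"

lemma ar_density_pos: "\<sigma> > 0 \<Longrightarrow> c\<^sup>2 < 1 \<Longrightarrow> ar_density c \<sigma> n x > 0"
  by (auto simp: ar_density_def intro!: prod_pos normal_density_pos cond_sd_pos)

lemma cond_mean_measurable [measurable]:
  "i \<le> n \<Longrightarrow> (\<lambda>x. cond_mean c x i) \<in> borel_measurable (obs_space n)"
  by (cases "i = 0") (auto simp: cond_mean_def[abs_def])

lemma ar_density_measurable [measurable]: "ar_density c \<sigma> n \<in> borel_measurable (obs_space n)"
  unfolding ar_density_def[abs_def] normal_density_def by measurable

text \<open>
  Integrating out the last coordinate amounts to one step of the Markov kernel. Working with
  nonnegative integrals makes the recursion free of integrability side conditions.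
\<close>
lemma nn_integral_ar_density_Suc:
  assumes \<sigma>: "\<sigma> > 0" and c: "c\<^sup>2 < 1"
    and [measurable]: "g \<in> borel_measurable (obs_space (Suc n))"
  shows "(\<integral>\<^sup>+x. ennreal (ar_density c \<sigma> (Suc n) x) * g x \<partial>obs_space (Suc n))
    = (\<integral>\<^sup>+x. ennreal (ar_density c \<sigma> n x) *
        (\<integral>\<^sup>+y. ennreal (normal_density (cond_mean c x n) (cond_sd c \<sigma> n) y) * g (x(Suc n := y)) \<partial>lborel)
        \<partial>obs_space n)"
proof -
  interpret product_sigma_finite "\<lambda>_::nat. lborel :: real measure" by standard
  have I: "{1..Suc n} = insert (Suc n) {1..n}" by auto
  have upd: "ar_density c \<sigma> (Suc n) (x(Suc n := y))
      = ar_density c \<sigma> n x * normal_density (cond_mean c x n) (cond_sd c \<sigma> n) y" for x y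
    by (auto simp: ar_density_def cond_mean_def intro!: arg_cong2[where f = "(*)"] prod.cong)
  have "(\<integral>\<^sup>+x. ennreal (ar_density c \<sigma> (Suc n) x) * g x \<partial>obs_space (Suc n))
      = (\<integral>\<^sup>+x. \<integral>\<^sup>+y. ennreal (ar_density c \<sigma> (Suc n) (x(Suc n := y))) * g (x(Suc n := y)) \<partial>lborel \<partial>obs_space n)"
    unfolding I by (rule product_nn_integral_insert) (auto simp flip: I)
  also have "\<dots> = (\<integral>\<^sup>+x. ennreal (ar_density c \<sigma> n x) *
        (\<integral>\<^sup>+y. ennreal (normal_density (cond_mean c x n) (cond_sd c \<sigma> n) y) * g (x(Suc n := y)) \<partial>lborel)
        \<partial>obs_space n)"
  proof (intro nn_integral_cong)
    fix x assume x: "x \<in> space (obs_space n)"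
    have "(\<lambda>y. x(Suc n := y)) \<in> measurable lborel (obs_space (Suc n))"
      unfolding I using x by (intro measurable_component_update) auto
    then have [measurable]: "(\<lambda>y. g (x(Suc n := y))) \<in> borel_measurable lborel" by measurable
    show "(\<integral>\<^sup>+y. ennreal (ar_density c \<sigma> (Suc n) (x(Suc n := y))) * g (x(Suc n := y)) \<partial>lborel)
        = ennreal (ar_density c \<sigma> n x) *
          (\<integral>\<^sup>+y. ennreal (normal_density (cond_mean c x n) (cond_sd c \<sigma> n) y) * g (x(Suc n := y)) \<partial>lborel)"
      unfolding upd using ar_density_pos[OF \<sigma> c, of n x]
      by (subst nn_integral_cmult[symmetric]) (auto simp: ennreal_mult less_imp_le mult.assoc)
  qed
  finally show ?thesis .
qed

lemma nn_integral_normal_density: "s > 0 \<Longrightarrow> (\<integral>\<^sup>+y. ennreal (normal_density m s y) \<partial>lborel) = 1"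
  by (subst nn_integral_eq_integral) auto

lemma nn_integral_normal_density_square:
  assumes s: "s > 0"
  shows "(\<integral>\<^sup>+y. ennreal (normal_density m s y) * ennreal ((y - t)\<^sup>2) \<partial>lborel) = ennreal (s\<^sup>2 + (m - t)\<^sup>2)"
proof -
  have "has_bochner_integral lborel
      (\<lambda>y. normal_density m s y * (y - m) ^ (2 * 1)
        + 2 * (m - t) * (normal_density m s y * (y - m) ^ (2 * 0 + 1))
        + (m - t)\<^sup>2 * (normal_density m s y * (y - m) ^ (2 * 0)))
      (fact (2 * 1) / ((2 / s\<^sup>2) ^ 1 * fact 1) + 2 * (m - t) * 0
        + (m - t)\<^sup>2 * (fact (2 * 0) / ((2 / s\<^sup>2) ^ 0 * fact 0)))"
    by (intro has_bochner_integral_add has_bochner_integral_mult_right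
        normal_moment_even[OF s] normal_moment_odd[OF s])
  also have "fact (2 * 1) / ((2 / s\<^sup>2) ^ 1 * fact 1) + 2 * (m - t) * 0
        + (m - t)\<^sup>2 * (fact (2 * 0) / ((2 / s\<^sup>2) ^ 0 * fact 0)) = s\<^sup>2 + (m - t)\<^sup>2"
    by simp
  also have "(\<lambda>y. normal_density m s y * (y - m) ^ (2 * 1)
        + 2 * (m - t) * (normal_density m s y * (y - m) ^ (2 * 0 + 1))
        + (m - t)\<^sup>2 * (normal_density m s y * (y - m) ^ (2 * 0)))
      = (\<lambda>y. normal_density m s y * (y - t)\<^sup>2)"
    by (rule ext) (simp add: algebra_simps power2_eq_square)
  finally have "has_bochner_integral lborel (\<lambda>y. normal_density m s y * (y - t)\<^sup>2) (s\<^sup>2 + (m - t)\<^sup>2)" .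
  then have int: "integrable lborel (\<lambda>y. normal_density m s y * (y - t)\<^sup>2)"
    "(\<integral>y. normal_density m s y * (y - t)\<^sup>2 \<partial>lborel) = s\<^sup>2 + (m - t)\<^sup>2"
    by (simp_all add: has_bochner_integral_iff)
  have "(\<integral>\<^sup>+y. ennreal (normal_density m s y) * ennreal ((y - t)\<^sup>2) \<partial>lborel)
      = (\<integral>\<^sup>+y. ennreal (normal_density m s y * (y - t)\<^sup>2) \<partial>lborel)"
    by (simp add: ennreal_mult)
  also have "\<dots> = ennreal (s\<^sup>2 + (m - t)\<^sup>2)"
    unfolding int(2)[symmetric] by (rule nn_integral_eq_integral[OF int(1)]) simp
  finally show ?thesis .
qed

text \<open>
  Later observations do not affect the law of earlier ones. A function of the first \<open>m\<close> coordinates is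
  expressed as a function that ignores updates beyond \<open>m\<close>, so that the same \<open>g\<close> can be integrated over
  windows of different lengths.
\<close>
lemma nn_integral_ar_density_marginal:
  assumes \<sigma>: "\<sigma> > 0" and c: "c\<^sup>2 < 1" and "m \<le> n"
    and meas: "\<And>k. m \<le> k \<Longrightarrow> g \<in> borel_measurable (obs_space k)"
    and upd: "\<And>x k y. m < k \<Longrightarrow> g (x(k := y)) = g x"
  shows "(\<integral>\<^sup>+x. ennreal (ar_density c \<sigma> n x) * g x \<partial>obs_space n)
    = (\<integral>\<^sup>+x. ennreal (ar_density c \<sigma> m x) * g x \<partial>obs_space m)"
  using \<open>m \<le> n\<close>
proof (induction n rule: dec_induct)
  case (step n)
  have "(\<integral>\<^sup>+x. ennreal (ar_density c \<sigma> (Suc n) x) * g x \<partial>obs_space (Suc n))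
      = (\<integral>\<^sup>+x. ennreal (ar_density c \<sigma> n x) * g x \<partial>obs_space n)"
    using step.hyps
    by (subst nn_integral_ar_density_Suc[OF \<sigma> c meas])
       (auto simp: upd nn_integral_multc nn_integral_normal_density cond_sd_pos[OF \<sigma> c])
  then show ?case using step by simp
qed simp

lemma nn_integral_ar_density:
  assumes "\<sigma> > 0" "c\<^sup>2 < 1"
  shows "(\<integral>\<^sup>+x. ennreal (ar_density c \<sigma> n x) \<partial>obs_space n) = 1"
proof -
  have "(\<integral>\<^sup>+x. ennreal (ar_density c \<sigma> n x) * 1 \<partial>obs_space n)
      = (\<integral>\<^sup>+x. ennreal (ar_density c \<sigma> 0 x) * 1 \<partial>obs_space 0)"
    by (rule nn_integral_ar_density_marginal[OF assms]) auto
  then show ?thesis by (simp add: ar_density_def PiM_empty nn_integral_count_space_finite)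
qed

text \<open>
  Predicting with coefficient \<open>b\<close> a process that runs with coefficient \<open>a\<close>: conditionally on the past,
  the mean squared error is the innovation variance plus the squared bias of the prediction.
\<close>
lemma nn_integral_prediction_error:
  assumes \<sigma>: "\<sigma> > 0" and a: "a\<^sup>2 < 1" and "i < n"
  shows "(\<integral>\<^sup>+x. ennreal (ar_density a \<sigma> n x) * ennreal ((x (Suc i) - cond_mean b x i)\<^sup>2) \<partial>obs_space n)
    = (\<integral>\<^sup>+x. ennreal (ar_density a \<sigma> i x) *
        ennreal ((cond_sd a \<sigma> i)\<^sup>2 + (cond_mean a x i - cond_mean b x i)\<^sup>2) \<partial>obs_space i)"
proof -
  let ?g = "\<lambda>x. ennreal ((x (Suc i) - cond_mean b x i)\<^sup>2)"
  have meas: "?g \<in> borel_measurable (obs_space k)" if "Suc i \<le> k" for k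
  proof -
    have [measurable]: "(\<lambda>x. cond_mean b x i) \<in> borel_measurable (obs_space k)"
      using that by (intro cond_mean_measurable) simp
    show ?thesis by measurable (use that in auto)
  qed
  have "(\<integral>\<^sup>+x. ennreal (ar_density a \<sigma> n x) * ?g x \<partial>obs_space n)
      = (\<integral>\<^sup>+x. ennreal (ar_density a \<sigma> (Suc i) x) * ?g x \<partial>obs_space (Suc i))"
    using \<open>i < n\<close> meas
    by (intro nn_integral_ar_density_marginal[OF \<sigma> a]) (auto simp: cond_mean_def)
  also have "\<dots> = (\<integral>\<^sup>+x. ennreal (ar_density a \<sigma> i x) *
        (\<integral>\<^sup>+y. ennreal (normal_density (cond_mean a x i) (cond_sd a \<sigma> i) y) *
          ennreal ((y - cond_mean b x i)\<^sup>2) \<partial>lborel) \<partial>obs_space i)"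
    by (subst nn_integral_ar_density_Suc[OF \<sigma> a meas]) (auto simp: cond_mean_def intro!: nn_integral_cong)
  finally show ?thesis
    by (simp add: nn_integral_normal_density_square cond_sd_pos[OF \<sigma> a])
qed

text \<open>
  Stationarity of the variance: \<open>v = \<sigma>\<^sup>2 / (1 - a\<^sup>2)\<close> is the fixed point of \<open>v \<mapsto> \<sigma>\<^sup>2 + a\<^sup>2 v\<close>. The recursion is the
  prediction error for the coefficient \<open>b = 0\<close>, whose prediction is zero.
\<close>
lemma nn_integral_ar_density_square:
  assumes \<sigma>: "\<sigma> > 0" and a: "a\<^sup>2 < 1"
  shows "(\<integral>\<^sup>+x. ennreal (ar_density a \<sigma> (Suc i) x) * ennreal ((x (Suc i))\<^sup>2) \<partial>obs_space (Suc i))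
    = ennreal (\<sigma>\<^sup>2 / (1 - a\<^sup>2))"
proof (induction i)
  case 0
  show ?case
    using nn_integral_prediction_error[OF \<sigma> a, of 0 1 0] a
    by (simp add: cond_mean_def cond_sd_square ar_density_def PiM_empty nn_integral_count_space_finite
        One_nat_def)
next
  case (Suc i)
  have "(\<integral>\<^sup>+x. ennreal (ar_density a \<sigma> (Suc (Suc i)) x) * ennreal ((x (Suc (Suc i)))\<^sup>2) \<partial>obs_space (Suc (Suc i)))
      = (\<integral>\<^sup>+x. ennreal (ar_density a \<sigma> (Suc i) x) * ennreal (\<sigma>\<^sup>2 + a\<^sup>2 * (x (Suc i))\<^sup>2) \<partial>obs_space (Suc i))"
    using nn_integral_prediction_error[OF \<sigma> a, of "Suc i" "Suc (Suc i)" 0] a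
    by (simp add: cond_mean_def cond_sd_square power_mult_distrib)
  also have "\<dots> = (\<integral>\<^sup>+x. ennreal (\<sigma>\<^sup>2) * ennreal (ar_density a \<sigma> (Suc i) x)
      + ennreal (a\<^sup>2) * (ennreal (ar_density a \<sigma> (Suc i) x) * ennreal ((x (Suc i))\<^sup>2)) \<partial>obs_space (Suc i))"
    by (intro nn_integral_cong) (simp add: ennreal_plus ennreal_mult algebra_simps)
  also have "\<dots> = ennreal (\<sigma>\<^sup>2) + ennreal (a\<^sup>2) * ennreal (\<sigma>\<^sup>2 / (1 - a\<^sup>2))"
    by (simp add: nn_integral_add nn_integral_cmult nn_integral_ar_density[OF \<sigma> a] Suc)
  also have "\<dots> = ennreal (\<sigma>\<^sup>2 + a\<^sup>2 * (\<sigma>\<^sup>2 / (1 - a\<^sup>2)))"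
    using a by (simp add: ennreal_plus ennreal_mult del: times_divide_eq_right)
  also have "\<sigma>\<^sup>2 + a\<^sup>2 * (\<sigma>\<^sup>2 / (1 - a\<^sup>2)) = \<sigma>\<^sup>2 / (1 - a\<^sup>2)"
    using a by (simp add: field_simps)
  finally show ?case .
qed

lemma prediction_error_moment:
  assumes \<sigma>: "\<sigma> > 0" and a: "a\<^sup>2 < 1" and "i < n"
  shows "has_bochner_integral (obs_space n)
      (\<lambda>x. ar_density a \<sigma> n x * (x (Suc i) - cond_mean b x i)\<^sup>2)
      (if i = 0 then \<sigma>\<^sup>2 / (1 - a\<^sup>2) else \<sigma>\<^sup>2 + (a - b)\<^sup>2 * (\<sigma>\<^sup>2 / (1 - a\<^sup>2)))"
    (is "has_bochner_integral _ _ ?r")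
proof (rule has_bochner_integral_nn_integral)
  show "0 \<le> ?r" using a by auto
  have "(\<integral>\<^sup>+x. ennreal (ar_density a \<sigma> i x) *
        ennreal ((cond_sd a \<sigma> i)\<^sup>2 + (cond_mean a x i - cond_mean b x i)\<^sup>2) \<partial>obs_space i) = ennreal ?r"
  proof (cases i)
    case 0
    then show ?thesis
      using a by (simp add: cond_mean_def cond_sd_square ar_density_def PiM_empty nn_integral_count_space_finite)
  next
    case (Suc k)
    have "(\<integral>\<^sup>+x. ennreal (ar_density a \<sigma> i x) *
        ennreal ((cond_sd a \<sigma> i)\<^sup>2 + (cond_mean a x i - cond_mean b x i)\<^sup>2) \<partial>obs_space i)
      = (\<integral>\<^sup>+x. ennreal (\<sigma>\<^sup>2) * ennreal (ar_density a \<sigma> i x)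
      + ennreal ((a - b)\<^sup>2) * (ennreal (ar_density a \<sigma> i x) * ennreal ((x i)\<^sup>2)) \<partial>obs_space i)"
      using Suc a
      by (intro nn_integral_cong)
         (simp add: cond_mean_def cond_sd_square power_mult_distrib ennreal_plus ennreal_mult
           distrib_left mult.left_commute mult.commute flip: left_diff_distrib)
    also have "\<dots> = ennreal (\<sigma>\<^sup>2) + ennreal ((a - b)\<^sup>2) * ennreal (\<sigma>\<^sup>2 / (1 - a\<^sup>2))"
      using Suc nn_integral_ar_density_square[OF \<sigma> a, of k]
      by (simp add: nn_integral_add nn_integral_cmult nn_integral_ar_density[OF \<sigma> a])
    also have "\<dots> = ennreal ?r"
      using a Suc by (simp add: ennreal_plus ennreal_mult del: times_divide_eq_right)
    finally show ?thesis .
  qed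
  then show "(\<integral>\<^sup>+x. ennreal (ar_density a \<sigma> n x * (x (Suc i) - cond_mean b x i)\<^sup>2) \<partial>obs_space n) = ennreal ?r"
    using nn_integral_prediction_error[OF \<sigma> a \<open>i < n\<close>, of b] ar_density_pos[OF \<sigma> a]
    by (simp add: ennreal_mult less_imp_le)
  show "(\<lambda>x. ar_density a \<sigma> n x * (x (Suc i) - cond_mean b x i)\<^sup>2) \<in> borel_measurable (obs_space n)"
  proof -
    have [measurable]: "(\<lambda>x. cond_mean b x i) \<in> borel_measurable (obs_space n)"
      using \<open>i < n\<close> by (intro cond_mean_measurable) simp
    show ?thesis by measurable (use \<open>i < n\<close> in auto)
  qed
qed (use ar_density_pos[OF \<sigma> a] in \<open>auto simp: less_imp_le\<close>)

section \<open>Divergence between two autoregressive laws\<close>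

lemma has_bochner_integral_ar_density:
  assumes "\<sigma> > 0" "c\<^sup>2 < 1"
  shows "has_bochner_integral (obs_space n) (ar_density c \<sigma> n) 1"
  by (rule has_bochner_integral_nn_integral)
     (use ar_density_pos[OF assms] in \<open>auto simp: nn_integral_ar_density[OF assms] less_imp_le\<close>)

lemma ln_normal_density:
  assumes "s > 0"
  shows "ln (normal_density m s y) = - ln (sqrt (2 * pi)) - ln s - (y - m)\<^sup>2 / (2 * s\<^sup>2)"
  using assms by (simp add: normal_density_def ln_mult ln_div ln_sqrt ln_realpow real_sqrt_mult)

lemma ar_log_likelihood_ratio:
  assumes \<sigma>: "\<sigma> > 0" and a: "a\<^sup>2 < 1" and b: "b\<^sup>2 < 1"
  shows "ln (ar_density a \<sigma> n x / ar_density b \<sigma> n x)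
    = (\<Sum>i<n. ln (cond_sd b \<sigma> i / cond_sd a \<sigma> i)
        + (x (Suc i) - cond_mean b x i)\<^sup>2 / (2 * (cond_sd b \<sigma> i)\<^sup>2)
        - (x (Suc i) - cond_mean a x i)\<^sup>2 / (2 * (cond_sd a \<sigma> i)\<^sup>2))"
proof -
  have ln_ar: "ln (ar_density c \<sigma> n x)
      = (\<Sum>i<n. - ln (sqrt (2 * pi)) - ln (cond_sd c \<sigma> i)
          - (x (Suc i) - cond_mean c x i)\<^sup>2 / (2 * (cond_sd c \<sigma> i)\<^sup>2))" if "c\<^sup>2 < 1" for c
  proof -
    have "normal_density m (cond_sd c \<sigma> i) y \<noteq> 0" for m y :: real and i :: nat
      by (rule less_imp_neq[OF normal_density_pos[OF cond_sd_pos[OF \<sigma> that]], symmetric])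
    then show ?thesis
      unfolding ar_density_def
      by (subst ln_prod) (simp_all add: ln_normal_density cond_sd_pos[OF \<sigma> that])
  qed
  have sd: "ln (cond_sd b \<sigma> i / cond_sd a \<sigma> i) = ln (cond_sd b \<sigma> i) - ln (cond_sd a \<sigma> i)" for i
    by (rule ln_divide_pos[OF cond_sd_pos[OF \<sigma> b] cond_sd_pos[OF \<sigma> a]])
  have ratio: "ln (ar_density a \<sigma> n x / ar_density b \<sigma> n x)
      = ln (ar_density a \<sigma> n x) - ln (ar_density b \<sigma> n x)"
    by (rule ln_divide_pos[OF ar_density_pos[OF \<sigma> a] ar_density_pos[OF \<sigma> b]])
  show ?thesis
    unfolding ratio ln_ar[OF a] ln_ar[OF b] sum_subtractf[symmetric]
    by (intro sum.cong) (simp_all add: sd)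
qed

text \<open>
  The divergence is computed by the chain rule, one coordinate at a time. The first coordinate
  contributes the divergence of the stationary marginals. Every later one contributes
  \<open>(a - b)\<^sup>2 / (2 (1 - a\<^sup>2))\<close>: the two transition densities have equal variance \<open>\<sigma>\<^sup>2\<close> and means that differ by
  \<open>(a - b) x i\<close>, and \<open>x i\<close> has variance \<open>\<sigma>\<^sup>2 / (1 - a\<^sup>2)\<close> under the first law. The sum is written so that
  the sign of its second term is visible.
\<close>
lemma kl_divergence_ar:
  assumes \<sigma>: "\<sigma> > 0" and a: "a\<^sup>2 < 1" and b: "b\<^sup>2 < 1" and n: "n > 0"
  shows "has_bochner_integral (obs_space n)
      (\<lambda>x. ar_density a \<sigma> n x * ln (ar_density a \<sigma> n x / ar_density b \<sigma> n x))
      (ln ((1 - a\<^sup>2) / (1 - b\<^sup>2)) / 2 + (b - a) * (real n * (b - a) - 2 * b) / (2 * (1 - a\<^sup>2)))"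
proof -
  let ?f = "ar_density a \<sigma> n" and ?sa = "cond_sd a \<sigma>" and ?sb = "cond_sd b \<sigma>"
  (* r c i is the mean squared error of predicting coordinate Suc i with coefficient c *)
  define r where "r c i = (if i = 0 then \<sigma>\<^sup>2 / (1 - a\<^sup>2)
      else \<sigma>\<^sup>2 + (a - c)\<^sup>2 * (\<sigma>\<^sup>2 / (1 - a\<^sup>2)))" for c and i :: nat
  define k where "k i = ln (?sb i / ?sa i) * 1 + 1 / (2 * (?sb i)\<^sup>2) * r b i
      - 1 / (2 * (?sa i)\<^sup>2) * r a i" for i
  have "has_bochner_integral (obs_space n)
      (\<lambda>x. \<Sum>i<n. ln (?sb i / ?sa i) * ?f x
        + 1 / (2 * (?sb i)\<^sup>2) * (?f x * (x (Suc i) - cond_mean b x i)\<^sup>2)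
        - 1 / (2 * (?sa i)\<^sup>2) * (?f x * (x (Suc i) - cond_mean a x i)\<^sup>2))
      (\<Sum>i<n. k i)"
    unfolding k_def r_def
    by (intro has_bochner_integral_sum has_bochner_integral_add has_bochner_integral_diff
        has_bochner_integral_mult_right has_bochner_integral_ar_density[OF \<sigma> a]
        prediction_error_moment[OF \<sigma> a]) auto
  also have "(\<lambda>x. \<Sum>i<n. ln (?sb i / ?sa i) * ?f x
        + 1 / (2 * (?sb i)\<^sup>2) * (?f x * (x (Suc i) - cond_mean b x i)\<^sup>2)
        - 1 / (2 * (?sa i)\<^sup>2) * (?f x * (x (Suc i) - cond_mean a x i)\<^sup>2))
      = (\<lambda>x. ?f x * ln (?f x / ar_density b \<sigma> n x))"
    unfolding ar_log_likelihood_ratio[OF \<sigma> a b] sum_distrib_left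
    by (intro ext sum.cong) (auto simp: algebra_simps)
  also have "(\<Sum>i<n. k i)
      = ln ((1 - a\<^sup>2) / (1 - b\<^sup>2)) / 2 + (b - a) * (real n * (b - a) - 2 * b) / (2 * (1 - a\<^sup>2))"
  proof -
    obtain m where m: "n = Suc m" using n by (cases n) auto
    have "?sb 0 / ?sa 0 = sqrt ((1 - a\<^sup>2) / (1 - b\<^sup>2))"
      using \<sigma> by (simp add: cond_sd_def real_sqrt_divide)
    then have "ln (?sb 0 / ?sa 0) = ln ((1 - a\<^sup>2) / (1 - b\<^sup>2)) / 2"
      using a b by (simp add: ln_sqrt)
    moreover have "1 / (2 * (?sb 0)\<^sup>2) * r b 0 - 1 / (2 * (?sa 0)\<^sup>2) * r a 0
        = (a\<^sup>2 - b\<^sup>2) / (2 * (1 - a\<^sup>2))"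
    proof -
      have "1 / (2 * (s / B)) * (s / A) - 1 / (2 * (s / A)) * (s / A) = (B - A) / (2 * A)"
        if "A > 0" "B > 0" "s > 0" for A B s :: real
        using that by (simp add: field_simps)
      from this[of "1 - a\<^sup>2" "1 - b\<^sup>2" "\<sigma>\<^sup>2"] show ?thesis
        using \<sigma> a b by (simp add: cond_sd_square r_def)
    qed
    ultimately have k0: "k 0 = ln ((1 - a\<^sup>2) / (1 - b\<^sup>2)) / 2 + (a\<^sup>2 - b\<^sup>2) / (2 * (1 - a\<^sup>2))"
      by (simp add: k_def)
    have kS: "k (Suc i) = (a - b)\<^sup>2 / (2 * (1 - a\<^sup>2))" for i
      using \<sigma> a b by (simp add: k_def cond_sd_def r_def field_simps)
    have "(\<Sum>i<n. k i) = k 0 + real m * ((a - b)\<^sup>2 / (2 * (1 - a\<^sup>2)))"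
      unfolding m by (subst sum.lessThan_Suc_shift) (simp add: kS)
    also have "\<dots> = ln ((1 - a\<^sup>2) / (1 - b\<^sup>2)) / 2
        + (a\<^sup>2 - b\<^sup>2 + real m * (a - b)\<^sup>2) / (2 * (1 - a\<^sup>2))"
      unfolding k0 by (simp add: add_divide_distrib)
    also have "a\<^sup>2 - b\<^sup>2 + real m * (a - b)\<^sup>2 = (b - a) * (real n * (b - a) - 2 * b)"
      unfolding m by (simp add: algebra_simps power2_eq_square)
    finally show ?thesis .
  qed
  finally show ?thesis .
qed

section \<open>Covertness\<close>

text \<open>
  With \<open>\<phi> y\<close> the probability of deciding \<open>H1\<close> after observing \<open>y\<close>, the false alarm probability is the
  mean of \<open>\<phi>\<close> under the first density and the miss detection probability is one minus its mean under the
  second, so their sum falls short of one by exactly the difference that Pinsker's inequality bounds.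
\<close>
lemma test_errors_ar:
  fixes d :: "(nat \<Rightarrow> real) \<times> 'r \<Rightarrow> hypothesis"
  assumes \<sigma>: "\<sigma> > 0" and a: "a\<^sup>2 < 1" and b: "b\<^sup>2 < 1"
    and M0: "prob_space M0" "steady_state M0 n a \<sigma> X0"
    and M1: "prob_space M1" "steady_state M1 n b \<sigma> X1"
    and d: "detection_test n R d"
    and kl: "has_bochner_integral (obs_space n)
      (\<lambda>x. ar_density a \<sigma> n x * ln (ar_density a \<sigma> n x / ar_density b \<sigma> n x)) K"
  shows "false_alarm_prob n M0 X0 R d + miss_detection_prob n M1 X1 R d \<ge> 1 - sqrt (K / 2)"
proof -
  let ?f0 = "ar_density a \<sigma> n" and ?f1 = "ar_density b \<sigma> n" and ?\<phi> = "decision_kernel H1 R d"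
  have law: "distributed M0 (obs_space n) (observation n X0) (\<lambda>y. ennreal (?f0 y))"
    "distributed M1 (obs_space n) (observation n X1) (\<lambda>y. ennreal (?f1 y))"
    using M0(2) M1(2)
    by (simp_all add: steady_state_def has_centered_normal_law_def \<sigma> a b
        centered_normal_density_stationary)
  note mass = has_bochner_integral_ar_density[OF \<sigma> a, of n] has_bochner_integral_ar_density[OF \<sigma> b, of n]
  note H1 = decision_prob_eq_integral[OF M0(1) d law(1) ar_density_measurable ar_density_pos[OF \<sigma> a], of H1]
  note H0 = decision_prob_eq_integral[OF M1(1) d law(2) ar_density_measurable ar_density_pos[OF \<sigma> b], of H0]
  interpret R: prob_space R using d by (simp add: detection_test_def)
  have \<phi>: "0 \<le> ?\<phi> y" "?\<phi> y \<le> 1" for y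
    by (simp_all add: decision_kernel_def)
  have "integrable (obs_space n) (\<lambda>y. ?f1 y * ?\<phi> y)"
  proof (rule Bochner_Integration.integrable_bound)
    show "integrable (obs_space n) ?f1" using mass(2) by (simp add: has_bochner_integral_iff)
    show "(\<lambda>y. ?f1 y * ?\<phi> y) \<in> borel_measurable (obs_space n)"
      using H1(1) by measurable
    show "AE y in obs_space n. norm (?f1 y * ?\<phi> y) \<le> norm (?f1 y)"
      using ar_density_pos[OF \<sigma> b] \<phi> by (intro AE_I2) (simp add: abs_mult mult_left_le)
  qed
  then have "(\<integral>y. ?f1 y - ?f1 y * ?\<phi> y \<partial>obs_space n) = 1 - (\<integral>y. ?f1 y * ?\<phi> y \<partial>obs_space n)"
    using mass(2) by (simp add: has_bochner_integral_iff)
  moreover have "(\<integral>y. ?f1 y * decision_kernel H0 R d y \<partial>obs_space n)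
      = (\<integral>y. ?f1 y - ?f1 y * ?\<phi> y \<partial>obs_space n)"
    using decision_kernel_H0[OF d]
    by (intro Bochner_Integration.integral_cong refl) (simp add: space_PiM right_diff_distrib)
  ultimately have "miss_detection_prob n M1 X1 R d = 1 - (\<integral>y. ?f1 y * ?\<phi> y \<partial>obs_space n)"
    unfolding miss_detection_prob_def H0(2) by simp
  moreover have "false_alarm_prob n M0 X0 R d = (\<integral>y. ?f0 y * ?\<phi> y \<partial>obs_space n)"
    unfolding false_alarm_prob_def by (rule H1(2))
  moreover have "(\<integral>y. ?f1 y * ?\<phi> y \<partial>obs_space n) - (\<integral>y. ?f0 y * ?\<phi> y \<partial>obs_space n) \<le> sqrt (K / 2)"
    by (rule pinsker_test_bound[OF _ _ H1(1) _ _ mass \<phi> kl])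
      (simp_all add: ar_density_pos[OF \<sigma>] a b)
  ultimately show ?thesis by linarith
qed

theorem theorem2:
  fixes a b \<sigma> \<epsilon> :: real
    and n :: nat
    and M0 :: "'p measure" and Z0 X0 :: "nat \<Rightarrow> 'p \<Rightarrow> real"
    and M1 :: "'q measure" and Z1 X1 :: "nat \<Rightarrow> 'q \<Rightarrow> real"
    and R :: "'r measure" and d :: "(nat \<Rightarrow> real) \<times> 'r \<Rightarrow> hypothesis"
  assumes "0 < \<bar>a\<bar>" and "\<bar>a\<bar> < \<bar>b\<bar>" and "\<bar>b\<bar> < 1" and "sgn a = sgn b"
    and "0 < \<sigma>"
    and "linear_system M0 a \<sigma> Z0 (\<lambda>k \<omega>. 0) X0"
    and "steady_state M0 n a \<sigma> X0"
    and "linear_system M1 a \<sigma> Z1 (\<lambda>k \<omega>. (a - b) * X1 (k - 1) \<omega>) X1"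
    and "steady_state M1 n b \<sigma> X1"
    and "real n < 2 * b / (b - a)"
    and "0 < \<epsilon>"
    and "\<bar>b\<bar> < sqrt (1 - (1 - a\<^sup>2) * exp (- 4 * \<epsilon>\<^sup>2))"
    and "detection_test n R d"
  shows "covert \<epsilon> (false_alarm_prob n M0 X0 R d) (miss_detection_prob n M1 X1 R d)"
proof -
  have a: "a\<^sup>2 < 1" and b: "b\<^sup>2 < 1"
    using assms(2,3) by (simp_all add: abs_square_less_1)
  have "\<exists>K < 2 * \<epsilon>\<^sup>2. has_bochner_integral (obs_space n)
      (\<lambda>x. ar_density a \<sigma> n x * ln (ar_density a \<sigma> n x / ar_density b \<sigma> n x)) K"
  proof (cases "n = 0")
    case True
    (* both laws of the empty observation coincide *)
    have "has_bochner_integral (obs_space n)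
      (\<lambda>x. ar_density a \<sigma> n x * ln (ar_density a \<sigma> n x / ar_density b \<sigma> n x)) 0"
      unfolding True by (simp add: ar_density_def has_bochner_integral_zero)
    then show ?thesis using \<open>0 < \<epsilon>\<close> by (intro exI[of _ 0]) simp
  next
    case False
    (* b and b - a have the same sign because b has the larger modulus, so multiplying the bound on the
       window length by b - a, and then by b - a again, yields this form for either sign *)
    have "(b - a) * (real n * (b - a) - 2 * b) \<le> 0"
    proof (cases "b > 0")
      case True
      then have "b - a > 0" using assms(2) by linarith
      then show ?thesis
        using assms(10) by (simp add: pos_less_divide_eq mult_nonneg_nonpos)
    next
      case False
      then have "b - a < 0" using assms(2) by linarith
      then show ?thesis
        using assms(10) by (simp add: neg_less_divide_eq mult_nonpos_nonneg)
    qed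
    then have "(b - a) * (real n * (b - a) - 2 * b) / (2 * (1 - a\<^sup>2)) \<le> 0"
      using a by (intro divide_nonpos_pos) auto
    (* the bound on b, solved for the ratio of the stationary variances *)
    moreover have "ln ((1 - a\<^sup>2) / (1 - b\<^sup>2)) < 4 * \<epsilon>\<^sup>2"
    proof -
      have "\<bar>b\<bar>\<^sup>2 < (sqrt (1 - (1 - a\<^sup>2) * exp (- 4 * \<epsilon>\<^sup>2)))\<^sup>2"
        using assms(12) by (intro power_strict_mono) auto
      moreover have "1 - (1 - a\<^sup>2) * exp (- 4 * \<epsilon>\<^sup>2) > 0"
        using assms(12) by (metis abs_ge_zero le_less_trans real_sqrt_gt_0_iff)
      ultimately have "(1 - a\<^sup>2) * exp (- (4 * \<epsilon>\<^sup>2)) < 1 - b\<^sup>2" by simp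
      then have "(1 - a\<^sup>2) * exp (- (4 * \<epsilon>\<^sup>2)) * exp (4 * \<epsilon>\<^sup>2) < (1 - b\<^sup>2) * exp (4 * \<epsilon>\<^sup>2)"
        by (intro mult_strict_right_mono) auto
      then have "1 - a\<^sup>2 < (1 - b\<^sup>2) * exp (4 * \<epsilon>\<^sup>2)"
        by (simp add: mult.assoc mult_exp_exp)
      then have "(1 - a\<^sup>2) / (1 - b\<^sup>2) < exp (4 * \<epsilon>\<^sup>2)"
        using b by (simp add: pos_divide_less_eq mult.commute)
      then have "ln ((1 - a\<^sup>2) / (1 - b\<^sup>2)) < ln (exp (4 * \<epsilon>\<^sup>2))"
        using a b by (subst ln_less_cancel_iff) auto
      then show ?thesis by simp
    qed
    ultimately show ?thesis
      using kl_divergence_ar[OF \<open>0 < \<sigma>\<close> a b, of n] False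
      by (intro exI[of _ "ln ((1 - a\<^sup>2) / (1 - b\<^sup>2)) / 2
          + (b - a) * (real n * (b - a) - 2 * b) / (2 * (1 - a\<^sup>2))"]) simp
  qed
  then obtain K where K: "K < 2 * \<epsilon>\<^sup>2" and kl: "has_bochner_integral (obs_space n)
      (\<lambda>x. ar_density a \<sigma> n x * ln (ar_density a \<sigma> n x / ar_density b \<sigma> n x)) K"
    by blast
  have "1 - sqrt (K / 2) \<le> false_alarm_prob n M0 X0 R d + miss_detection_prob n M1 X1 R d"
    using assms by (intro test_errors_ar[OF \<open>0 < \<sigma>\<close> a b _ _ _ _ _ kl]) (auto simp: linear_system_def)
  moreover have "sqrt (K / 2) \<le> \<epsilon>"
    using K \<open>0 < \<epsilon>\<close> by (intro real_le_lsqrt) auto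
  ultimately show ?thesis by (simp add: covert_def)
qed

end
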